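(* Let $(A_1,B_1),\dots,(A_k,B_k)\in\Sigma^2$ be a Streett acceptance condition, and suppose $$\mathsf P_\mu\Big(\bigcap_{i=1}^k\mathrm{Fin}(A_i)\cup\mathrm{Inf}(B_i)\Big)>0.$$ Then for every $\varepsilon>0$ there exist a region $I\in\Sigma$ and regions $J_i\in\Sigma$ with $J_i\subseteq I\setminus A_i$ ($i=1,\dots,k$) with the following properties. - For every $i$, $$\sup_{s\in J_i}\mathsf P_{\delta_s}(\sigma_{A_i}<\infty)<1\qquad\text{and}\qquad \inf_{s\in I}\mathsf P_{\delta_s}\big(\sigma_{B_i\cup J_i\cup I^{c}}<\infty\big)=1.$$ - Moreover, $$\mathsf P_\mu(I^\omega)\ge\mathsf P_\mu\Big(\bigcap_{i=1}^k\mathrm{Fin}(A_i)\cup\mathrm{Inf}(B_i)\Big)-\varepsilon.$$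
   Context: Setting. - $(S,\Sigma)$ is a measurable space. $\Omega=S^\omega$ carries the product $\sigma$-algebra, and $\Phi_n$ is the $n$-th coordinate map. - $\mu$ is a probability measure on $(S,\Sigma)$ and $P$ is a transition probability kernel. - $\mathsf P_\mu$ is the law of the time-homogeneous Markov chain $(\Phi_n)$ with initial distribution $\mu$ and kernel $P$. - $\mathsf P_{\delta_s}$ is the same law started from the Dirac measure at $s$. Events and times. - $\mathrm{Fin}(A)=\bigcup_{n}\bigcap_{m\ge n}\{\Phi_m\notin A\}$ and $\mathrm{Inf}(A)=\bigcap_n\bigcup_{m\ge n}\{\Phi_m\in A\}$. - The first return time is $\sigma_A=\inf\{n\ge1:\Phi_n\in A\}$, with $\inf\emptyset=\infty$. - $I^c=S\setminus I$ and $I^\omega=\{\Phi_n\in I\ \forall n\ge0\}$. - A Streett acceptance condition is a finite sequence of pairs in $\Sigma^2$. *)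

theory Defs
  imports "HOL-Probability.Probability"
begin

abbreviation path_space :: "'a measure \<Rightarrow> (nat \<Rightarrow> 'a) measure" where
  "path_space M \<equiv> PiM UNIV (\<lambda>_. M)"

text \<open>The conditional law of the \<open>n\<close>-th state given the states \<open>\<omega> 0, \<dots>, \<omega> (n - 1)\<close>.\<close>

definition chain_kernel ::
    "('a \<Rightarrow> 'a measure) \<Rightarrow> 'a measure \<Rightarrow> nat \<Rightarrow> (nat \<Rightarrow> 'a) \<Rightarrow> 'a measure" where
  "chain_kernel P \<mu> n \<omega> = (case n of 0 \<Rightarrow> \<mu> | Suc m \<Rightarrow> P (\<omega> m))"

text \<open>
  The constant \<open>Ionescu_Tulcea.CI\<close> gives the finite-dimensional distributions and
  \<open>projective_family.lim\<close> their projective limit on the path space. Outside their locales these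
  constants are meaningful only when the locale assumptions hold; lemma
  \<open>Ionescu_Tulcea_chain_kernel\<close> discharges them.
\<close>

definition markov_law ::
    "'a measure \<Rightarrow> ('a \<Rightarrow> 'a measure) \<Rightarrow> 'a measure \<Rightarrow> (nat \<Rightarrow> 'a) measure" where
  "markov_law M P \<mu> =
     projective_family.lim UNIV (Ionescu_Tulcea.CI (chain_kernel P \<mu>) (\<lambda>_. M)) (\<lambda>_. M)"

lemma Ionescu_Tulcea_chain_kernel:
  assumes P: "P \<in> M \<rightarrow>\<^sub>M prob_algebra M" and \<mu>: "\<mu> \<in> space (prob_algebra M)"
  shows "Ionescu_Tulcea (chain_kernel P \<mu>) (\<lambda>_. M)"
proof (rule Ionescu_Tulcea.intro)
  fix n :: nat
  have [measurable]: "P \<in> M \<rightarrow>\<^sub>M subprob_algebra M"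
    using P by (rule measurable_prob_algebraD)
  have \<mu>': "\<mu> \<in> space (subprob_algebra M)"
    using \<mu> by (auto simp: space_prob_algebra space_subprob_algebra
        intro: prob_space_imp_subprob_space)
  show "chain_kernel P \<mu> n \<in> PiM {0..<n} (\<lambda>_. M) \<rightarrow>\<^sub>M subprob_algebra M"
  proof (cases n)
    case 0
    then show ?thesis using \<mu>' by (simp add: chain_kernel_def[abs_def])
  next
    case (Suc m)
    then have "(\<lambda>\<omega>. \<omega> m) \<in> PiM {0..<n} (\<lambda>_. M) \<rightarrow>\<^sub>M M"
      by (intro measurable_component_singleton) auto
    then show ?thesis using Suc by (simp add: chain_kernel_def[abs_def])
  qed
next
  fix n :: nat and \<omega> assume \<omega>: "\<omega> \<in> space (PiM {0..<n} (\<lambda>_. M))"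
  show "prob_space (chain_kernel P \<mu> n \<omega>)"
  proof (cases n)
    case 0
    then show ?thesis using \<mu> by (simp add: chain_kernel_def space_prob_algebra)
  next
    case (Suc m)
    with \<omega> have "\<omega> m \<in> space M" by (auto simp: space_PiM PiE_iff)
    from measurable_space[OF P this] show ?thesis
      using Suc by (simp add: chain_kernel_def space_prob_algebra)
  qed
qed

definition Fin :: "'a measure \<Rightarrow> 'a set \<Rightarrow> (nat \<Rightarrow> 'a) set" where
  "Fin M A = (\<Union>n. \<Inter>m\<in>{n..}. {\<omega> \<in> space (path_space M). \<omega> m \<notin> A})"

definition Infin :: "'a measure \<Rightarrow> 'a set \<Rightarrow> (nat \<Rightarrow> 'a) set" where
  "Infin M A = (\<Inter>n. \<Union>m\<in>{n..}. {\<omega> \<in> space (path_space M). \<omega> m \<in> A})"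

text \<open>The intersection with the path space only matters for \<open>k = 0\<close>.\<close>

definition streett ::
    "'a measure \<Rightarrow> nat \<Rightarrow> (nat \<Rightarrow> 'a set) \<Rightarrow> (nat \<Rightarrow> 'a set) \<Rightarrow> (nat \<Rightarrow> 'a) set" where
  "streett M k A B =
     space (path_space M) \<inter> (\<Inter>i\<in>{1..k}. Fin M (A i) \<union> Infin M (B i))"

definition return_time :: "'a set \<Rightarrow> (nat \<Rightarrow> 'a) \<Rightarrow> enat" where
  "return_time A \<omega> = Inf {enat n | n. n \<ge> 1 \<and> \<omega> n \<in> A}"

definition returns :: "'a measure \<Rightarrow> 'a set \<Rightarrow> (nat \<Rightarrow> 'a) set" where
  "returns M A = {\<omega> \<in> space (path_space M). return_time A \<omega> < \<infinity>}"

definition stays :: "'a measure \<Rightarrow> 'a set \<Rightarrow> (nat \<Rightarrow> 'a) set" where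
  "stays M I = {\<omega> \<in> space (path_space M). \<forall>n. \<omega> n \<in> I}"

end

theory Submission
  imports Defs
begin

text \<open>
  Let \<open>W\<close> be the Streett event and \<open>h s\<close> its probability from \<open>s\<close>. Take \<open>I = {h \<ge> d}\<close> for a small
  \<open>d\<close>, and let \<open>J i\<close> consist of the states of \<open>I - A i\<close> from which \<open>A i\<close> is reached with probability
  at most \<open>1/2\<close>. By the Markov property at the first exit from \<open>I\<close>, the paths of \<open>W\<close> that leave \<open>I\<close>
  have probability at most \<open>d\<close>. Conversely, almost every path that stays in \<open>I\<close> lies in \<open>W\<close>, and
  almost every path with finitely many visits to \<open>A i\<close> has states from which the probability of
  returning to \<open>A i\<close> is at most \<open>1/2\<close>. Both statements are instances of one zero-one principle:
  if, along the paths of an event \<open>E\<close>, the conditional probability of a future event \<open>V\<close> is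
  eventually bounded away from zero although \<open>V\<close> does not occur, then \<open>E\<close> is null.
\<close>

section \<open>Path shifts and prefix events\<close>

definition path_shift :: "nat \<Rightarrow> (nat \<Rightarrow> 'a) \<Rightarrow> nat \<Rightarrow> 'a" where
  "path_shift n \<omega> = (\<lambda>i. \<omega> (n + i))"

lemma path_shift_apply: "path_shift n \<omega> i = \<omega> (n + i)"
  by (simp add: path_shift_def)

lemma measurable_path_shift [measurable]: "path_shift n \<in> path_space M \<rightarrow>\<^sub>M path_space M"
  unfolding path_shift_def by (rule measurable_PiM_single') (auto simp: space_PiM)

lemma path_shift_in_space: "\<omega> \<in> space (path_space M) \<Longrightarrow> path_shift n \<omega> \<in> space (path_space M)"
  by (rule measurable_space[OF measurable_path_shift])

text \<open>This plays the role of the sigma-algebra generated by coordinates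
  \<open>0, ..., n\<close>. Encoding it by invariance under changes after time \<open>n\<close>
  keeps every event a set of infinite paths and makes membership a pointwise check.\<close>

definition prefix_events :: "'a measure \<Rightarrow> nat \<Rightarrow> (nat \<Rightarrow> 'a) set set" where
  "prefix_events M n = {C \<in> sets (path_space M).
     \<forall>\<omega>\<in>space (path_space M). \<forall>\<omega>'\<in>space (path_space M).
       (\<forall>i\<le>n. \<omega> i = \<omega>' i) \<longrightarrow> (\<omega> \<in> C \<longleftrightarrow> \<omega>' \<in> C)}"

lemma prefix_eventsI:
  assumes "C \<in> sets (path_space M)"
    and "\<And>\<omega> \<omega>'. \<omega> \<in> space (path_space M) \<Longrightarrow> \<omega>' \<in> space (path_space M) \<Longrightarrow>
      (\<And>i. i \<le> n \<Longrightarrow> \<omega> i = \<omega>' i) \<Longrightarrow> \<omega> \<in> C \<Longrightarrow> \<omega>' \<in> C"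
  shows "C \<in> prefix_events M n"
proof -
  have "\<omega> \<in> C \<longleftrightarrow> \<omega>' \<in> C"
    if "\<omega> \<in> space (path_space M)" "\<omega>' \<in> space (path_space M)" "\<forall>i\<le>n. \<omega> i = \<omega>' i" for \<omega> \<omega>'
    using assms(2)[of \<omega> \<omega>'] assms(2)[of \<omega>' \<omega>] that by metis
  then show ?thesis unfolding prefix_events_def using assms(1) by blast
qed

lemma prefix_events_sets: "C \<in> prefix_events M n \<Longrightarrow> C \<in> sets (path_space M)"
  by (simp add: prefix_events_def)

lemma prefix_events_cong:
  "C \<in> prefix_events M n \<Longrightarrow> \<omega> \<in> space (path_space M) \<Longrightarrow> \<omega>' \<in> space (path_space M) \<Longrightarrow>
    (\<And>i. i \<le> n \<Longrightarrow> \<omega> i = \<omega>' i) \<Longrightarrow> \<omega> \<in> C \<longleftrightarrow> \<omega>' \<in> C"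
  unfolding prefix_events_def by blast

lemma prefix_events_mono: "C \<in> prefix_events M n \<Longrightarrow> n \<le> m \<Longrightarrow> C \<in> prefix_events M m"
  using le_trans unfolding prefix_events_def by blast

lemma prefix_events_Int:
  "C \<in> prefix_events M n \<Longrightarrow> D \<in> prefix_events M n \<Longrightarrow> C \<inter> D \<in> prefix_events M n"
  unfolding prefix_events_def by blast

lemma prefix_events_coordinate:
  assumes "i \<le> n" "A \<in> sets M"
  shows "{\<omega> \<in> space (path_space M). \<omega> i \<in> A} \<in> prefix_events M n"
  using assms by (intro prefix_eventsI) auto

text \<open>Two prefix events can be compared at the longer of their two prefixes, so the increasing
  union over \<open>n\<close> is closed under finite operations.\<close>

lemma algebra_prefix_events:
  "algebra (space (path_space M)) (\<Union>n. prefix_events M n)"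
  unfolding algebra_iff_Int
proof (intro conjI ballI)
  show "(\<Union>n. prefix_events M n) \<subseteq> Pow (space (path_space M))"
    by (auto dest!: prefix_events_sets sets.sets_into_space)
  show "{} \<in> (\<Union>n. prefix_events M n)"
    by (auto simp: prefix_events_def)
  show "space (path_space M) - C \<in> (\<Union>n. prefix_events M n)" if "C \<in> (\<Union>n. prefix_events M n)" for C
  proof -
    from that obtain n where "C \<in> prefix_events M n" by auto
    then have "space (path_space M) - C \<in> prefix_events M n"
      unfolding prefix_events_def by blast
    then show ?thesis by auto
  qed
  fix C D assume "C \<in> (\<Union>n. prefix_events M n)" "D \<in> (\<Union>n. prefix_events M n)"
  then obtain n m where "C \<in> prefix_events M n" "D \<in> prefix_events M m" by auto
  then have "C \<inter> D \<in> prefix_events M (max n m)"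
    by (intro prefix_events_Int) (auto elim: prefix_events_mono)
  then show "C \<inter> D \<in> (\<Union>n. prefix_events M n)" by auto
qed

text \<open>Every one-coordinate cylinder is a prefix event, and these cylinders generate the
  product sigma-algebra.\<close>

lemma sets_path_space_prefix_events:
  "sets (path_space M) = sigma_sets (space (path_space M)) (\<Union>n. prefix_events M n)"
proof
  show "sigma_sets (space (path_space M)) (\<Union>n. prefix_events M n) \<subseteq> sets (path_space M)"
    by (intro sets.sigma_sets_subset) (auto simp: prefix_events_def)
  show "sets (path_space M) \<subseteq> sigma_sets (space (path_space M)) (\<Union>n. prefix_events M n)"
    unfolding sets_PiM_single space_PiM[symmetric]
  proof (intro sigma_sets_mono', safe)
    fix i :: nat and A assume "A \<in> sets M"
    then show "{f \<in> space (path_space M). f i \<in> A} \<in> (\<Union>n. prefix_events M n)"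
      using prefix_events_coordinate[of i i] by auto
  qed
qed

section \<open>Approximation by an algebra\<close>

text \<open>Events approximable in symmetric difference form a sigma-algebra. Complements exchange
  the two differences; a countable union is first cut to finitely many sets by continuity of the
  measure, and those are approximated one by one.\<close>

lemma (in finite_measure) approximate_by_algebra:
  assumes "algebra (space M) G" and sets: "sets M = sigma_sets (space M) G"
    and "E \<in> sets M" and "0 < (e :: real)"
  shows "\<exists>C\<in>G. measure M (E - C) + measure M (C - E) < e"
proof -
  interpret algebra "space M" G by fact
  have G: "C \<in> sets M" if "C \<in> G" for C
    using that by (auto simp: sets)
  have "E \<in> sigma_sets (space M) G" using assms by simp
  then show ?thesis using \<open>0 < e\<close>
  proof (induction arbitrary: e)
    case (Basic a)
    then show ?case by (intro bexI[of _ a]) auto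
  next
    case Empty
    then show ?case by (intro bexI[of _ "{}"]) auto
  next
    case (Compl a)
    then obtain C where C: "C \<in> G" "measure M (a - C) + measure M (C - a) < e" by blast
    have a: "a \<in> sets M" using Compl.hyps by (simp add: sets)
    have "(space M - a) - (space M - C) = C - a" "(space M - C) - (space M - a) = a - C"
      using sets.sets_into_space[OF a] sets.sets_into_space[OF G[OF C(1)]] by auto
    then show ?case using C by (intro bexI[of _ "space M - C"]) auto
  next
    case (Union a)
    have a: "a i \<in> sets M" for i using Union.hyps by (simp add: sets)
    have "(\<lambda>n. measure M (\<Union>i<n. a i)) \<longlonglongrightarrow> measure M (\<Union>n. \<Union>i<n. a i)"
      using a by (intro finite_Lim_measure_incseq) (auto simp: incseq_def intro: less_le_trans)
    moreover have "(\<Union>n. \<Union>i<n. a i) = (\<Union>i. a i)" by auto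
    ultimately have "(\<lambda>n. measure M (\<Union>i<n. a i)) \<longlonglongrightarrow> measure M (\<Union>i. a i)" by simp
    then have "\<exists>n. norm (measure M (\<Union>i<n. a i) - measure M (\<Union>i. a i)) < e / 2"
      using LIMSEQ_D[of _ _ "e / 2"] \<open>0 < e\<close> by fastforce
    then obtain n where "norm (measure M (\<Union>i<n. a i) - measure M (\<Union>i. a i)) < e / 2" ..
    moreover have "measure M ((\<Union>i. a i) - (\<Union>i<n. a i)) = measure M (\<Union>i. a i) - measure M (\<Union>i<n. a i)"
      using a by (intro finite_measure_Diff) auto
    ultimately have n: "measure M ((\<Union>i. a i) - (\<Union>i<n. a i)) < e / 2" unfolding real_norm_def by linarith
    \<comment> \<open>The truncation costs less than \<open>e / 2\<close>; the other half is shared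
      among \<open>n\<close> sets. Dividing by \<open>Suc n\<close> also covers
      \<open>n = 0\<close>.\<close>
    have "\<exists>C\<in>G. measure M (a i - C) + measure M (C - a i) < e / (2 * Suc n)" for i
      using Union.IH[of "e / (2 * Suc n)" i] \<open>0 < e\<close> by simp
    then obtain C where C: "\<And>i. C i \<in> G"
        "\<And>i. measure M (a i - C i) + measure M (C i - a i) < e / (2 * Suc n)"
      by metis
    let ?C = "\<Union>i<n. C i"
    have CG: "?C \<in> G" using C by (intro finite_UN) auto
    have mC: "C i \<in> sets M" for i using C G by auto
    have "measure M ((\<Union>i. a i) - ?C) \<le> measure M (((\<Union>i. a i) - (\<Union>i<n. a i)) \<union> (\<Union>i<n. a i - C i))"
      using a mC by (intro finite_measure_mono) auto
    also have "\<dots> \<le> measure M ((\<Union>i. a i) - (\<Union>i<n. a i)) + measure M (\<Union>i<n. a i - C i)"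
      using a mC by (intro measure_Un_le) auto
    also have "measure M (\<Union>i<n. a i - C i) \<le> (\<Sum>i<n. measure M (a i - C i))"
      using a mC by (intro finite_measure_subadditive_finite) auto
    finally have 1: "measure M ((\<Union>i. a i) - ?C)
      \<le> measure M ((\<Union>i. a i) - (\<Union>i<n. a i)) + (\<Sum>i<n. measure M (a i - C i))" by simp
    have "measure M (?C - (\<Union>i. a i)) \<le> measure M (\<Union>i<n. C i - a i)"
      using a mC by (intro finite_measure_mono) auto
    also have "\<dots> \<le> (\<Sum>i<n. measure M (C i - a i))"
      using a mC by (intro finite_measure_subadditive_finite) auto
    finally have "measure M (?C - (\<Union>i. a i)) \<le> (\<Sum>i<n. measure M (C i - a i))" .
    then have "measure M ((\<Union>i. a i) - ?C) + measure M (?C - (\<Union>i. a i))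
      \<le> measure M ((\<Union>i. a i) - (\<Union>i<n. a i))
        + (\<Sum>i<n. measure M (a i - C i) + measure M (C i - a i))"
      using 1 by (simp add: sum.distrib)
    also have "(\<Sum>i<n. measure M (a i - C i) + measure M (C i - a i)) \<le> (\<Sum>i<n. e / (2 * Suc n))"
      using C by (intro sum_mono less_imp_le)
    also have "\<dots> \<le> e / 2" using \<open>0 < e\<close> by (simp add: field_simps)
    finally have "measure M ((\<Union>i. a i) - ?C) + measure M (?C - (\<Union>i. a i)) < e"
      using n by linarith
    then show ?case using CG by blast
  qed
qed

section \<open>The Markov property\<close>

locale markov_kernel =
  fixes M :: "'a measure" and P :: "'a \<Rightarrow> 'a measure"
  assumes P [measurable]: "P \<in> M \<rightarrow>\<^sub>M prob_algebra M"
begin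

lemma P_subprob [measurable]: "P \<in> M \<rightarrow>\<^sub>M subprob_algebra M"
  by (rule measurable_prob_algebraD) (rule P)

lemma return_in_prob_algebra: "s \<in> space M \<Longrightarrow> return M s \<in> space (prob_algebra M)"
  by (simp add: space_prob_algebra prob_space_return)

section \<open>The law of the chain and its one-step transitions\<close>

context
  fixes \<mu> assumes \<mu>: "\<mu> \<in> space (prob_algebra M)"
begin

interpretation Ionescu_Tulcea "chain_kernel P \<mu>" "\<lambda>_. M"
  by (rule Ionescu_Tulcea_chain_kernel[OF P \<mu>])

lemma sets_markov_law [measurable_cong]: "sets (markov_law M P \<mu>) = sets (path_space M)"
  by (simp add: markov_law_def)

lemma space_markov_law: "space (markov_law M P \<mu>) = space (path_space M)"
  by (simp add: markov_law_def)

text \<open>The total mass survives projection to the empty set of coordinates, where the marginal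
  is a probability measure by the projective family.\<close>

lemma prob_space_markov_law: "prob_space (markov_law M P \<mu>)"
proof -
  have "prob_space (distr (markov_law M P \<mu>) (PiM {} (\<lambda>_. M)) (\<lambda>x. restrict x {}))"
    unfolding markov_law_def by (subst distr_lim) (auto intro: PF.prob_space_P)
  then show ?thesis
    by (rule prob_space_distrD[rotated]) (auto intro!: measurable_restrict simp: markov_law_def)
qed

text \<open>The Ionescu-Tulcea measure started from the empty history
  \<open>\<lambda>_. undefined\<close>, the only point of the empty product. Here \<open>n\<close>
  counts coordinates \<open>0, ..., n - 1\<close>, whereas \<open>prefix_events M n\<close> also
  sees coordinate \<open>n\<close>.\<close>

private abbreviation prefix_law where
  "prefix_law n \<equiv> C 0 n (\<lambda>_. undefined)"

private lemma sets_prefix_law [measurable_cong]: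
  "sets (prefix_law n) = sets (PiM {0..<n} (\<lambda>_. M))"
  by (subst sets_C) (auto simp: space_PiM)

private lemma distr_prefix:
  "distr (markov_law M P \<mu>) (PiM {0..<n} (\<lambda>_. M)) (\<lambda>x. restrict x {0..<n}) = prefix_law n"
  unfolding markov_law_def
proof (subst distr_lim, simp, rule measure_eqI)
  show "sets (CI {0..<n}) = sets (prefix_law n)"
    by (simp add: CI_def sets_prefix_law)
  fix X assume "X \<in> sets (CI {0..<n})"
  then have X: "X \<in> sets (PiM {0..<n} (\<lambda>_. M))" by (simp add: CI_def)
  have "PF.emb {0..<n} {0..<n} X = X"
    using sets.sets_into_space[OF X] by (intro prod_emb_id) (simp add: space_PiM)
  then show "emeasure (CI {0..<n}) X = emeasure (prefix_law n) X"
    using emeasure_CI[OF subset_refl X] by simp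
qed

private lemma nn_integral_prefix:
  assumes [measurable]: "f \<in> borel_measurable (PiM {0..<n} (\<lambda>_. M))"
  shows "(\<integral>\<^sup>+\<omega>. f (restrict \<omega> {0..<n}) \<partial>markov_law M P \<mu>) = (\<integral>\<^sup>+x. f x \<partial>prefix_law n)"
  unfolding distr_prefix[symmetric]
  by (subst nn_integral_distr) (auto intro!: measurable_restrict simp: sets_markov_law)

text \<open>The next stage of the construction binds \<open>prefix_law n\<close> with
  \<open>eP n\<close>, which appends a coordinate drawn from \<open>chain_kernel\<close>.\<close>

private lemma nn_integral_prefix_Suc:
  assumes [measurable]: "f \<in> borel_measurable (PiM {0..<Suc n} (\<lambda>_. M))"
  shows "(\<integral>\<^sup>+x. f x \<partial>prefix_law (Suc n)) =
    (\<integral>\<^sup>+x. (\<integral>\<^sup>+y. f (fun_upd x n y) \<partial>chain_kernel P \<mu> n x) \<partial>prefix_law n)"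
proof -
  have "(\<integral>\<^sup>+x. f x \<partial>prefix_law (Suc n)) = (\<integral>\<^sup>+x. (\<integral>\<^sup>+y. f y \<partial>eP n x) \<partial>prefix_law n)"
    using measurable_eP[of n]
    by (simp, subst nn_integral_bind[where B="PiM {0..<Suc n} (\<lambda>_. M)"])
       (auto simp: measurable_cong_sets[OF sets_prefix_law refl])
  also have "\<dots> = (\<integral>\<^sup>+x. (\<integral>\<^sup>+y. f (fun_upd x n y) \<partial>chain_kernel P \<mu> n x) \<partial>prefix_law n)"
    by (intro nn_integral_cong nn_integral_eP)
       (auto simp: sets_eq_imp_space_eq[OF sets_prefix_law])
  finally show ?thesis .
qed

lemma nn_integral_initial:
  assumes [measurable]: "f \<in> borel_measurable M"
  shows "(\<integral>\<^sup>+\<omega>. f (\<omega> 0) \<partial>markov_law M P \<mu>) = (\<integral>\<^sup>+s. f s \<partial>\<mu>)"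
proof -
  have "(\<integral>\<^sup>+\<omega>. f (\<omega> 0) \<partial>markov_law M P \<mu>) =
      (\<integral>\<^sup>+\<omega>. f (restrict \<omega> {0..<Suc 0} 0) \<partial>markov_law M P \<mu>)"
    by simp
  also have "\<dots> = (\<integral>\<^sup>+x. f (x 0) \<partial>prefix_law (Suc 0))"
    by (rule nn_integral_prefix) measurable
  also have "\<dots> = (\<integral>\<^sup>+x. (\<integral>\<^sup>+y. f (fun_upd x 0 y 0) \<partial>chain_kernel P \<mu> 0 x) \<partial>prefix_law 0)"
    by (rule nn_integral_prefix_Suc) measurable
  also have "\<dots> = (\<integral>\<^sup>+x. (\<integral>\<^sup>+y. f y \<partial>\<mu>) \<partial>prefix_law 0)"
    by (simp add: chain_kernel_def)
  also have "\<dots> = (\<integral>\<^sup>+y. f y \<partial>\<mu>)"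
    using prob_space.emeasure_space_1[OF prob_space_C[of "\<lambda>_. undefined" 0 0]]
    by (simp add: space_PiM)
  finally show ?thesis .
qed

text \<open>One-step Markov property against an arbitrary past event. The multi-step statements
  below come from iterating it.\<close>

lemma nn_integral_step:
  assumes E: "E \<in> prefix_events M n" and f [measurable]: "f \<in> borel_measurable M"
  shows "(\<integral>\<^sup>+\<omega>. indicator E \<omega> * f (\<omega> (Suc n)) \<partial>markov_law M P \<mu>) =
    (\<integral>\<^sup>+\<omega>. indicator E \<omega> * (\<integral>\<^sup>+t. f t \<partial>P (\<omega> n)) \<partial>markov_law M P \<mu>)"
proof -
  obtain s0 where s0: "s0 \<in> space M"
    using non_empty by blast
  \<comment> \<open>Filling the coordinates after \<open>n\<close> with a fixed state turns a finite
    prefix into a path. Membership in \<open>E\<close> does not notice the filling, so the indicator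
    of \<open>E\<close> becomes a function on a finite product.\<close>
  define ext where "ext x = (\<lambda>i. if i \<le> n then x i else s0)" for x :: "nat \<Rightarrow> 'a"
  have ext [measurable]: "ext \<in> PiM {0..<m} (\<lambda>_. M) \<rightarrow>\<^sub>M path_space M" if "n < m" for m
    unfolding ext_def
  proof (rule measurable_PiM_single')
    show "(\<lambda>x. if i \<le> n then x i else s0) \<in> PiM {0..<m} (\<lambda>_. M) \<rightarrow>\<^sub>M M" for i
      using that s0 by (cases "i \<le> n") auto
  qed (use that s0 in \<open>auto simp: space_PiM PiE_iff\<close>)
  note [measurable] = prefix_events_sets[OF E]
  have ext_iff: "ext (restrict \<omega> {0..<m}) \<in> E \<longleftrightarrow> \<omega> \<in> E"
    if "\<omega> \<in> space (path_space M)" "n < m" for \<omega> m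
    using that by (intro prefix_events_cong[OF E]) (auto simp: space_PiM PiE_iff ext_def s0)
  have "(\<integral>\<^sup>+\<omega>. indicator E \<omega> * f (\<omega> (Suc n)) \<partial>markov_law M P \<mu>) =
      (\<integral>\<^sup>+\<omega>. indicator E (ext (restrict \<omega> {0..<Suc (Suc n)})) * f (restrict \<omega> {0..<Suc (Suc n)} (Suc n))
        \<partial>markov_law M P \<mu>)"
    by (intro nn_integral_cong) (auto simp: space_markov_law ext_iff split: split_indicator)
  also have "\<dots> = (\<integral>\<^sup>+x. indicator E (ext x) * f (x (Suc n)) \<partial>prefix_law (Suc (Suc n)))"
    by (rule nn_integral_prefix) measurable
  also have "\<dots> = (\<integral>\<^sup>+x. (\<integral>\<^sup>+y. indicator E (ext (fun_upd x (Suc n) y)) * f (fun_upd x (Suc n) y (Suc n))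
      \<partial>chain_kernel P \<mu> (Suc n) x) \<partial>prefix_law (Suc n))"
    by (rule nn_integral_prefix_Suc) measurable
  also have "\<dots> = (\<integral>\<^sup>+x. indicator E (ext x) * (\<integral>\<^sup>+t. f t \<partial>P (x n)) \<partial>prefix_law (Suc n))"
  proof (intro nn_integral_cong)
    fix x assume "x \<in> space (prefix_law (Suc n))"
    then have "x n \<in> space M"
      unfolding sets_eq_imp_space_eq[OF sets_prefix_law] by (auto simp: space_PiM PiE_iff)
    then have "sets (P (x n)) = sets M"
      using P_subprob by (rule subprob_measurableD(2)[rotated])
    with f have [measurable]: "f \<in> borel_measurable (P (x n))"
      by (simp cong: measurable_cong_sets)
    \<comment> \<open>The new coordinate \<open>Suc n\<close> is overwritten by \<open>ext\<close>,
      so the indicator is constant in \<open>y\<close> and leaves the inner integral.\<close>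
    have "ext (fun_upd x (Suc n) y) = ext x" for y
      by (auto simp: ext_def)
    then show "(\<integral>\<^sup>+y. indicator E (ext (fun_upd x (Suc n) y)) * f (fun_upd x (Suc n) y (Suc n))
        \<partial>chain_kernel P \<mu> (Suc n) x) = indicator E (ext x) * (\<integral>\<^sup>+t. f t \<partial>P (x n))"
      by (simp add: chain_kernel_def nn_integral_cmult)
  qed
  also have "\<dots> = (\<integral>\<^sup>+\<omega>. indicator E (ext (restrict \<omega> {0..<Suc n})) *
      (\<integral>\<^sup>+t. f t \<partial>P (restrict \<omega> {0..<Suc n} n)) \<partial>markov_law M P \<mu>)"
    by (rule nn_integral_prefix[symmetric]) measurable
  also have "\<dots> = (\<integral>\<^sup>+\<omega>. indicator E \<omega> * (\<integral>\<^sup>+t. f t \<partial>P (\<omega> n)) \<partial>markov_law M P \<mu>)"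
    by (intro nn_integral_cong) (auto simp: space_markov_law ext_iff split: split_indicator)
  finally show ?thesis .
qed

end

section \<open>Finite-dimensional probabilities as iterated integrals\<close>

primrec box_prob :: "nat \<Rightarrow> (nat \<Rightarrow> 'a set) \<Rightarrow> 'a \<Rightarrow> ennreal" where
  "box_prob 0 X s = 1"
| "box_prob (Suc m) X s = indicator (X 0) s * (\<integral>\<^sup>+t. box_prob m (\<lambda>i. X (Suc i)) t \<partial>P s)"

text \<open>Since \<open>box_prob\<close> is built from \<open>P\<close> alone and not from the path
  law, measurability in the starting state follows by induction; it is later transferred to the path
  laws.\<close>

lemma borel_measurable_box_prob [measurable]:
  "(\<And>i. X i \<in> sets M) \<Longrightarrow> box_prob m X \<in> borel_measurable M"
proof (induction m arbitrary: X)
  case 0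
  have "box_prob 0 X = (\<lambda>_. 1)" by auto
  then show ?case by simp
next
  case (Suc m)
  have "box_prob (Suc m) X = (\<lambda>s. indicator (X 0) s * (\<integral>\<^sup>+t. box_prob m (\<lambda>i. X (Suc i)) t \<partial>P s))"
    by auto
  moreover have [measurable]: "box_prob m (\<lambda>i. X (Suc i)) \<in> borel_measurable M" "X 0 \<in> sets M"
    using Suc by auto
  ultimately show ?case by simp
qed

text \<open>Induction on the length of the box: its first constraint joins the past event, time
  advances by one, and \<open>nn_integral_step\<close> integrates out the new state. Hence
  \<open>C\<close>, \<open>n\<close> and \<open>X\<close> vary in the induction.\<close>

lemma emeasure_prefix_box:
  assumes \<mu>: "\<mu> \<in> space (prob_algebra M)"
  shows "C \<in> prefix_events M n \<Longrightarrow> (\<And>i. X i \<in> sets M) \<Longrightarrow>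
    emeasure (markov_law M P \<mu>) (C \<inter> {\<omega> \<in> space (path_space M). \<forall>i<m. \<omega> (n + i) \<in> X i}) =
    (\<integral>\<^sup>+\<omega>. indicator C \<omega> * box_prob m X (\<omega> n) \<partial>markov_law M P \<mu>)"
proof (induction m arbitrary: C n X)
  case 0
  then have "C \<in> sets (path_space M)" by (simp add: prefix_events_sets)
  then show ?case
    by (simp add: sets_markov_law[OF \<mu>] Int_absorb2 sets.sets_into_space)
next
  case (Suc m)
  let ?D = "C \<inter> {\<omega> \<in> space (path_space M). \<omega> n \<in> X 0}"
  have D: "?D \<in> prefix_events M n"
    using Suc.prems by (intro prefix_events_Int prefix_events_coordinate) auto
  have C: "C \<in> sets (path_space M)" using Suc.prems by (simp add: prefix_events_sets)
  have *: "(\<forall>i<Suc m. \<omega> (n + i) \<in> X i) \<longleftrightarrow> \<omega> n \<in> X 0 \<and> (\<forall>i<m. \<omega> (Suc n + i) \<in> X (Suc i))"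
    for \<omega> :: "nat \<Rightarrow> 'a"
    by (simp add: All_less_Suc2)
  have "C \<inter> {\<omega> \<in> space (path_space M). \<forall>i<Suc m. \<omega> (n + i) \<in> X i} =
      ?D \<inter> {\<omega> \<in> space (path_space M). \<forall>i<m. \<omega> (Suc n + i) \<in> X (Suc i)}"
    unfolding * by auto
  then have "emeasure (markov_law M P \<mu>) (C \<inter> {\<omega> \<in> space (path_space M). \<forall>i<Suc m. \<omega> (n + i) \<in> X i}) =
      (\<integral>\<^sup>+\<omega>. indicator ?D \<omega> * box_prob m (\<lambda>i. X (Suc i)) (\<omega> (Suc n)) \<partial>markov_law M P \<mu>)"
    using Suc.IH[of ?D "Suc n" "\<lambda>i. X (Suc i)"] prefix_events_mono[OF D, of "Suc n"] Suc.prems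
    by simp
  also have "\<dots> = (\<integral>\<^sup>+\<omega>. indicator ?D \<omega> * (\<integral>\<^sup>+t. box_prob m (\<lambda>i. X (Suc i)) t \<partial>P (\<omega> n)) \<partial>markov_law M P \<mu>)"
    using Suc.prems by (intro nn_integral_step[OF \<mu> D]) auto
  also have "\<dots> = (\<integral>\<^sup>+\<omega>. indicator C \<omega> * box_prob (Suc m) X (\<omega> n) \<partial>markov_law M P \<mu>)"
    by (intro nn_integral_cong) (auto simp: space_markov_law[OF \<mu>] split: split_indicator)
  finally show ?case .
qed

lemma emeasure_return_box:
  assumes "s \<in> space M" "\<And>i. X i \<in> sets M"
  shows "emeasure (markov_law M P (return M s)) {\<omega> \<in> space (path_space M). \<forall>i<m. \<omega> i \<in> X i} =
    box_prob m X s"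
proof -
  note \<mu> = return_in_prob_algebra[OF assms(1)]
  have "space (path_space M) \<in> prefix_events M 0"
    by (intro prefix_eventsI) auto
  from emeasure_prefix_box[OF \<mu> this, of X m] assms(2)
  have "emeasure (markov_law M P (return M s)) {\<omega> \<in> space (path_space M). \<forall>i<m. \<omega> i \<in> X i} =
      (\<integral>\<^sup>+\<omega>. indicator (space (path_space M)) \<omega> * box_prob m X (\<omega> 0) \<partial>markov_law M P (return M s))"
    by (simp add: Int_absorb1 subset_eq)
  also have "\<dots> = (\<integral>\<^sup>+\<omega>. box_prob m X (\<omega> 0) \<partial>markov_law M P (return M s))"
    by (intro nn_integral_cong) (auto simp: space_markov_law[OF \<mu>])
  also have "\<dots> = box_prob m X s"
    using assms by (subst nn_integral_initial[OF \<mu>]) (auto simp: nn_integral_return)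
  finally show ?thesis .
qed

text \<open>Giving free coordinates the constraint \<open>space M\<close> turns a cylinder over any
  finite index set into a box over an initial segment, the form that \<open>box_prob\<close>
  handles.\<close>

lemma prod_emb_eq_box:
  assumes "finite J" "\<forall>i\<in>J. A i \<in> sets M"
  shows "\<exists>m X. (\<forall>i. X i \<in> sets M) \<and>
    prod_emb UNIV (\<lambda>_. M) J (Pi\<^sub>E J A) = {\<omega> \<in> space (path_space M). \<forall>i<m. \<omega> i \<in> X i}"
proof (intro exI conjI allI)
  let ?X = "\<lambda>i. if i \<in> J then A i else space M"
  show "?X i \<in> sets M" for i using assms by auto
  \<comment> \<open>For empty \<open>J\<close> the value \<open>Max J\<close> is unspecified, but
    then every constraint is \<open>space M\<close> and any length serves.\<close>
  have "i < Suc (Max J)" if "i \<in> J" for i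
    using assms(1) that by (simp add: le_imp_less_Suc)
  then show "prod_emb UNIV (\<lambda>_. M) J (Pi\<^sub>E J A) =
      {\<omega> \<in> space (path_space M). \<forall>i<Suc (Max J). \<omega> i \<in> ?X i}"
    by (auto simp: prod_emb_def space_PiM PiE_iff)
qed

section \<open>The kernel of path laws and the Markov property at a fixed time\<close>

lemma measurable_markov_law [measurable]:
  "(\<lambda>s. markov_law M P (return M s)) \<in> M \<rightarrow>\<^sub>M prob_algebra (path_space M)"
\<comment> \<open>Cylinders are an intersection-stable generator, so measurability in
  \<open>s\<close> is checked on them, where the law equals \<open>box_prob\<close>.\<close>
proof (rule measurable_prob_algebra_generated[OF sets_PiM Int_stable_prod_algebra prod_algebra_sets_into_space])
  fix s assume "s \<in> space M"
  note \<mu> = return_in_prob_algebra[OF this]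
  show "prob_space (markov_law M P (return M s))"
    by (rule prob_space_markov_law[OF \<mu>])
  show "sets (markov_law M P (return M s)) = sets (path_space M)"
    by (rule sets_markov_law[OF \<mu>])
next
  fix E :: "(nat \<Rightarrow> 'a) set" assume "E \<in> prod_algebra UNIV (\<lambda>_. M)"
  then obtain J :: "nat set" and A where E: "E = prod_emb UNIV (\<lambda>_. M) J (Pi\<^sub>E J A)"
    and J: "finite J" "\<forall>i\<in>J. A i \<in> sets M"
    by (rule prod_algebraE) (rule that, assumption, assumption, blast)
  obtain m X where X: "\<forall>i. X i \<in> sets M"
    "prod_emb UNIV (\<lambda>_. M) J (Pi\<^sub>E J A) = {\<omega> \<in> space (path_space M). \<forall>i<m. \<omega> i \<in> X i}"
    using prod_emb_eq_box[OF J] by (elim exE conjE)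
  show "(\<lambda>s. emeasure (markov_law M P (return M s)) E) \<in> borel_measurable M"
    unfolding E X(2) using X(1)
    by (subst measurable_cong[OF emeasure_return_box]) auto
qed

lemma borel_measurable_emeasure_markov_law:
  assumes "V \<in> sets (path_space M)"
  shows "(\<lambda>s. emeasure (markov_law M P (return M s)) V) \<in> borel_measurable M"
  using measurable_emeasure_kernel[OF measurable_prob_algebraD[OF measurable_markov_law] assms] .

text \<open>Both sides are measures in \<open>V\<close>. They agree on cylinders by
  \<open>emeasure_prefix_box\<close> and \<open>emeasure_return_box\<close>, and the left one is
  finite, so they agree everywhere.\<close>

lemma markov_property:
  assumes \<mu>: "\<mu> \<in> space (prob_algebra M)"
    and C: "C \<in> prefix_events M n" and V: "V \<in> sets (path_space M)"
  shows "emeasure (markov_law M P \<mu>) (C \<inter> {\<omega> \<in> space (path_space M). path_shift n \<omega> \<in> V}) =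
    (\<integral>\<^sup>+\<omega>. indicator C \<omega> * emeasure (markov_law M P (return M (\<omega> n))) V \<partial>markov_law M P \<mu>)"
proof -
  let ?L = "markov_law M P \<mu>" and ?K = "\<lambda>\<omega>. markov_law M P (return M (\<omega> n))"
  interpret L: prob_space ?L by (rule prob_space_markov_law[OF \<mu>])
  note [measurable_cong] = sets_markov_law[OF \<mu>]
  note [measurable] = prefix_events_sets[OF C] measurable_prob_algebraD[OF measurable_markov_law]
  \<comment> \<open>The law restricted to \<open>C\<close>, without normalisation: a density keeps
    the whole path space as carrier, so shifting and binding make sense even if \<open>C\<close> is
    null.\<close>
  define N where "N = density ?L (indicator C)"
  have [measurable_cong]: "sets N = sets (path_space M)"
    by (simp add: N_def sets_markov_law[OF \<mu>])
  have space_N: "space N = space (path_space M)"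
    by (simp add: N_def space_markov_law[OF \<mu>])
  have ne: "space N \<noteq> {}"
    using L.not_empty by (simp add: N_def)
  have K: "?K \<in> N \<rightarrow>\<^sub>M subprob_algebra (path_space M)" by measurable
  have emeasure_distr_N: "emeasure (distr N (path_space M) (path_shift n)) W =
      emeasure ?L (C \<inter> {\<omega> \<in> space (path_space M). path_shift n \<omega> \<in> W})"
    if [measurable]: "W \<in> sets (path_space M)" for W
  proof -
    have "emeasure (distr N (path_space M) (path_shift n)) W =
        emeasure N {\<omega> \<in> space (path_space M). path_shift n \<omega> \<in> W}"
      by (subst emeasure_distr) (auto simp: space_N vimage_def Int_def intro!: arg_cong[where f="emeasure N"])
    also have "\<dots> = (\<integral>\<^sup>+\<omega>. indicator (C \<inter> {\<omega> \<in> space (path_space M). path_shift n \<omega> \<in> W}) \<omega> \<partial>?L)"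
      unfolding N_def
      by (subst emeasure_density) (auto simp del: nn_integral_indicator intro!: nn_integral_cong split: split_indicator)
    also have "\<dots> = emeasure ?L (C \<inter> {\<omega> \<in> space (path_space M). path_shift n \<omega> \<in> W})"
      by (rule nn_integral_indicator) measurable
    finally show ?thesis .
  qed
  have emeasure_bind_N: "emeasure (N \<bind> ?K) W = (\<integral>\<^sup>+\<omega>. indicator C \<omega> * emeasure (?K \<omega>) W \<partial>?L)"
    if [measurable]: "W \<in> sets (path_space M)" for W
  proof -
    have [measurable]: "(\<lambda>\<omega>. emeasure (?K \<omega>) W) \<in> borel_measurable ?L"
      using borel_measurable_emeasure_markov_law[OF that] by measurable
    show ?thesis
      by (subst emeasure_bind[OF ne K that], unfold N_def, subst nn_integral_density) auto
  qed
  have "distr N (path_space M) (path_shift n) = N \<bind> ?K"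
  proof (rule measure_eqI_PiM_infinite)
    show "sets (N \<bind> ?K) = sets (path_space M)"
      using ne by (intro sets_bind sets_kernel[OF K]) auto
    show "finite_measure (distr N (path_space M) (path_shift n))"
      by (rule finite_measureI) (simp add: emeasure_distr_N)
    fix A and J :: "nat set" assume "finite J" "\<And>i. i \<in> J \<Longrightarrow> A i \<in> sets M"
    then have J: "finite J" "\<forall>i\<in>J. A i \<in> sets M" by auto
    obtain m X where X: "\<forall>i. X i \<in> sets M"
      "prod_emb UNIV (\<lambda>_. M) J (Pi\<^sub>E J A) = {\<omega> \<in> space (path_space M). \<forall>i<m. \<omega> i \<in> X i}"
      using prod_emb_eq_box[OF J] by (elim exE conjE)
    let ?W = "{\<omega> \<in> space (path_space M). \<forall>i<m. \<omega> i \<in> X i}"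
    have W: "?W \<in> sets (path_space M)" using X(1) by measurable
    have "emeasure ?L (C \<inter> {\<omega> \<in> space (path_space M). path_shift n \<omega> \<in> ?W}) =
        emeasure ?L (C \<inter> {\<omega> \<in> space (path_space M). \<forall>i<m. \<omega> (n + i) \<in> X i})"
      by (intro arg_cong[where f="emeasure ?L"]) (auto simp: path_shift_in_space path_shift_apply)
    also have "\<dots> = (\<integral>\<^sup>+\<omega>. indicator C \<omega> * box_prob m X (\<omega> n) \<partial>?L)"
      using X(1) by (intro emeasure_prefix_box[OF \<mu> C]) auto
    also have "\<dots> = (\<integral>\<^sup>+\<omega>. indicator C \<omega> * emeasure (?K \<omega>) ?W \<partial>?L)"
    proof (intro nn_integral_cong)
      fix \<omega> assume "\<omega> \<in> space ?L"
      then have "\<omega> n \<in> space M" by (auto simp: space_markov_law[OF \<mu>] space_PiM)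
      then have "emeasure (?K \<omega>) ?W = box_prob m X (\<omega> n)"
        using X(1) by (intro emeasure_return_box) auto
      then show "indicator C \<omega> * box_prob m X (\<omega> n) = indicator C \<omega> * emeasure (?K \<omega>) ?W"
        by simp
    qed
    finally show "emeasure (distr N (path_space M) (path_shift n)) (prod_emb UNIV (\<lambda>_. M) J (Pi\<^sub>E J A)) =
        emeasure (N \<bind> ?K) (prod_emb UNIV (\<lambda>_. M) J (Pi\<^sub>E J A))"
      unfolding X(2) emeasure_distr_N[OF W] emeasure_bind_N[OF W] .
  qed simp
  then show ?thesis
    using emeasure_distr_N[OF V] emeasure_bind_N[OF V] by simp
qed

section \<open>Bounds on the probability of a shifted event\<close>

lemma emeasure_prefix_shift_ge:
  assumes \<mu>: "\<mu> \<in> space (prob_algebra M)"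
    and C: "C \<in> prefix_events M n" and V: "V \<in> sets (path_space M)"
    and E: "E \<in> sets (path_space M)"
    and le: "\<And>\<omega>. \<omega> \<in> E \<Longrightarrow> d \<le> emeasure (markov_law M P (return M (\<omega> n))) V"
  shows "d * emeasure (markov_law M P \<mu>) (C \<inter> E) \<le>
    emeasure (markov_law M P \<mu>) (C \<inter> {\<omega> \<in> space (path_space M). path_shift n \<omega> \<in> V})"
proof -
  have "C \<inter> E \<in> sets (markov_law M P \<mu>)"
    using prefix_events_sets[OF C] E by (simp add: sets_markov_law[OF \<mu>] sets.Int)
  then have "d * emeasure (markov_law M P \<mu>) (C \<inter> E) =
      (\<integral>\<^sup>+\<omega>. d * indicator (C \<inter> E) \<omega> \<partial>markov_law M P \<mu>)"
    by (rule nn_integral_cmult_indicator[symmetric])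
  \<comment> \<open>The event \<open>E\<close> may depend on the whole path. The Markov integrand is
    nonnegative, so its integral over \<open>C\<close> dominates the part over
    \<open>C \<inter> E\<close>, where the bound by \<open>d\<close> holds.\<close>
  also have "\<dots> \<le> (\<integral>\<^sup>+\<omega>. indicator C \<omega> * emeasure (markov_law M P (return M (\<omega> n))) V \<partial>markov_law M P \<mu>)"
    using le by (intro nn_integral_mono) (auto split: split_indicator)
  also have "\<dots> = emeasure (markov_law M P \<mu>) (C \<inter> {\<omega> \<in> space (path_space M). path_shift n \<omega> \<in> V})"
    by (rule markov_property[OF \<mu> C V, symmetric])
  finally show ?thesis .
qed

lemma emeasure_prefix_shift_le:
  assumes \<mu>: "\<mu> \<in> space (prob_algebra M)"
    and C: "C \<in> prefix_events M n" and V: "V \<in> sets (path_space M)"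
    and le: "\<And>\<omega>. \<omega> \<in> C \<Longrightarrow> emeasure (markov_law M P (return M (\<omega> n))) V \<le> d"
  shows "emeasure (markov_law M P \<mu>) (C \<inter> {\<omega> \<in> space (path_space M). path_shift n \<omega> \<in> V})
    \<le> d * emeasure (markov_law M P \<mu>) C"
proof -
  have "emeasure (markov_law M P \<mu>) (C \<inter> {\<omega> \<in> space (path_space M). path_shift n \<omega> \<in> V}) =
      (\<integral>\<^sup>+\<omega>. indicator C \<omega> * emeasure (markov_law M P (return M (\<omega> n))) V \<partial>markov_law M P \<mu>)"
    by (rule markov_property[OF \<mu> C V])
  also have "\<dots> \<le> (\<integral>\<^sup>+\<omega>. d * indicator C \<omega> \<partial>markov_law M P \<mu>)"
    using le by (intro nn_integral_mono) (auto split: split_indicator)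
  also have "\<dots> = d * emeasure (markov_law M P \<mu>) C"
    using prefix_events_sets[OF C] by (intro nn_integral_cmult_indicator) (simp add: sets_markov_law[OF \<mu>])
  finally show ?thesis .
qed

text \<open>
  This replaces Levy's zero-one law. If a prefix event \<open>C\<close> approximates \<open>E\<close>, then the shifted
  event \<open>V\<close> meets \<open>C\<close> in probability at least \<open>d\<close> times that of \<open>C \<inter> E\<close>; but it is disjoint
  from \<open>E\<close>, so it meets \<open>C\<close> only in the small set \<open>C - E\<close>.
\<close>

lemma null_event:
  assumes \<mu>: "\<mu> \<in> space (prob_algebra M)"
    and V: "V \<in> sets (path_space M)" and E: "E \<in> sets (path_space M)" and d: "0 < (d :: real)"
    and le: "\<And>\<omega> n. \<omega> \<in> E \<Longrightarrow> N \<le> n \<Longrightarrow> ennreal d \<le> emeasure (markov_law M P (return M (\<omega> n))) V"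
    and disj: "\<And>\<omega> n. \<omega> \<in> E \<Longrightarrow> N \<le> n \<Longrightarrow> path_shift n \<omega> \<notin> V"
  shows "emeasure (markov_law M P \<mu>) E = 0"
proof -
  let ?L = "markov_law M P \<mu>"
  interpret L: prob_space ?L by (rule prob_space_markov_law[OF \<mu>])
  note sets_L = sets_markov_law[OF \<mu>]
  have bound: "d * measure ?L E \<le> (1 + d) * e" if "0 < e" for e
  proof -
    have "\<exists>C\<in>(\<Union>n. prefix_events M n). measure ?L (E - C) + measure ?L (C - E) < e"
      using L.approximate_by_algebra[of "\<Union>n. prefix_events M n" E e] algebra_prefix_events[of M]
        sets_path_space_prefix_events[of M] E that
      by (simp add: sets_L space_markov_law[OF \<mu>])
    then obtain C k where C: "C \<in> prefix_events M k"
      and e: "measure ?L (E - C) + measure ?L (C - E) < e" by auto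
    \<comment> \<open>At least \<open>k\<close>, so that \<open>C\<close> is decided by time
      \<open>?n\<close>; at least \<open>N\<close>, so that the hypotheses on \<open>E\<close>
      apply.\<close>
    let ?n = "max k N"
    have Cn: "C \<in> prefix_events M ?n" using C by (rule prefix_events_mono) simp
    have Cs: "C \<in> sets (path_space M)" by (rule prefix_events_sets[OF C])
    have "ennreal d * emeasure ?L (C \<inter> E) \<le>
        emeasure ?L (C \<inter> {\<omega> \<in> space (path_space M). path_shift ?n \<omega> \<in> V})"
      using le by (intro emeasure_prefix_shift_ge[OF \<mu> Cn V E]) simp
    also have "\<dots> \<le> emeasure ?L (C - E)"
      using disj Cs E by (intro emeasure_mono) (auto simp: sets_L)
    finally have "d * measure ?L (C \<inter> E) \<le> measure ?L (C - E)"
      using d by (simp add: L.emeasure_eq_measure ennreal_mult[symmetric])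
    moreover have "measure ?L E \<le> measure ?L (C \<inter> E) + measure ?L (E - C)"
      using Cs E measure_Un_le[of "C \<inter> E" ?L "E - C"] Int_Diff_Un[of E C] by (simp add: sets_L Int_commute)
    then have "d * measure ?L E \<le> d * measure ?L (C \<inter> E) + d * measure ?L (E - C)"
      using d by (simp add: distrib_left[symmetric])
    ultimately have "d * measure ?L E \<le> measure ?L (C - E) + d * measure ?L (E - C)" by simp
    also have "\<dots> \<le> e + d * e"
      using e d measure_nonneg[of ?L "E - C"] measure_nonneg[of ?L "C - E"]
      by (intro add_mono mult_left_mono) linarith+
    finally show ?thesis by (simp add: algebra_simps)
  qed
  have "d * measure ?L E \<le> 0"
  proof (rule field_le_epsilon)
    fix e :: real assume "0 < e"
    moreover have "(1 + d) * (e / (1 + d)) = e" using d by simp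
    ultimately show "d * measure ?L E \<le> 0 + e"
      using bound[of "e / (1 + d)"] d by simp
  qed
  then have "measure ?L E = 0"
    using d measure_nonneg[of ?L E] by (simp add: mult_le_0_iff)
  then show ?thesis by (simp add: L.emeasure_eq_measure)
qed

end

section \<open>Streett conditions\<close>

lemma returns_iff:
  "\<omega> \<in> returns M A \<longleftrightarrow> \<omega> \<in> space (path_space M) \<and> (\<exists>n\<ge>1. \<omega> n \<in> A)"
proof -
  have "return_time A \<omega> < \<infinity> \<longleftrightarrow> (\<exists>n\<ge>1. \<omega> n \<in> A)"
    unfolding return_time_def Inf_less_iff by auto
  then show ?thesis by (simp add: returns_def)
qed

lemma sets_returns [measurable]:
  assumes [measurable]: "A \<in> sets M"
  shows "returns M A \<in> sets (path_space M)"
proof -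
  have "returns M A = {\<omega> \<in> space (path_space M). \<exists>n\<ge>1. \<omega> n \<in> A}"
    by (auto simp: returns_iff)
  then show ?thesis by simp
qed

lemma sets_stays:
  assumes [measurable]: "A \<in> sets M"
  shows "stays M A \<in> sets (path_space M)"
  unfolding stays_def by measurable

lemma Fin_iff:
  "\<omega> \<in> Fin M A \<longleftrightarrow> \<omega> \<in> space (path_space M) \<and> (\<exists>n. \<forall>m\<ge>n. \<omega> m \<notin> A)"
  by (auto simp: Fin_def)

lemma Infin_iff:
  "\<omega> \<in> Infin M A \<longleftrightarrow> \<omega> \<in> space (path_space M) \<and> (\<forall>n. \<exists>m\<ge>n. \<omega> m \<in> A)"
  by (auto simp: Infin_def)

lemma sets_streett:
  assumes "\<And>i. i \<in> {1..k} \<Longrightarrow> A i \<in> sets M" "\<And>i. i \<in> {1..k} \<Longrightarrow> B i \<in> sets M"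
  shows "streett M k A B \<in> sets (path_space M)"
proof -
  have "Fin M (A i) \<union> Infin M (B i) \<in> sets (path_space M)" if "i \<in> {1..k}" for i
  proof -
    note [measurable] = assms[OF that]
    show ?thesis unfolding Fin_def Infin_def by measurable
  qed
  then show ?thesis
    \<comment> \<open>Closure under finite intersections requires a nonempty index set; for
      \<open>k = 0\<close> the event is the whole path space.\<close>
    unfolding streett_def by (cases "k = 0") (auto intro!: sets.Int sets.finite_INT)
qed

lemma Fin_path_shift:
  assumes "\<omega> \<in> space (path_space M)"
  shows "path_shift n \<omega> \<in> Fin M A \<longleftrightarrow> \<omega> \<in> Fin M A"
proof -
  have "(\<exists>N. \<forall>m\<ge>N. \<omega> (n + m) \<notin> A) \<longleftrightarrow> (\<exists>N. \<forall>m\<ge>N. \<omega> m \<notin> A)"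
    using eventually_sequentially_seg[of "\<lambda>m. \<omega> m \<notin> A" n]
    by (simp add: eventually_sequentially add.commute)
  then show ?thesis using assms by (simp add: Fin_iff path_shift_in_space path_shift_apply)
qed

lemma Infin_path_shift:
  assumes "\<omega> \<in> space (path_space M)"
  shows "path_shift n \<omega> \<in> Infin M A \<longleftrightarrow> \<omega> \<in> Infin M A"
proof -
  have "\<omega>' \<in> Infin M A \<longleftrightarrow> \<omega>' \<notin> Fin M A" if "\<omega>' \<in> space (path_space M)" for \<omega>'
    using that by (auto simp: Fin_iff Infin_iff)
  then show ?thesis using assms by (simp add: Fin_path_shift path_shift_in_space)
qed

text \<open>The Streett event is a tail event. Hence its conditional probability given the first
  \<open>n + 1\<close> states is its probability from the current state, and the Markov property
  applies to it at every time.\<close>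

lemma streett_path_shift:
  "\<omega> \<in> space (path_space M) \<Longrightarrow> path_shift n \<omega> \<in> streett M k A B \<longleftrightarrow> \<omega> \<in> streett M k A B"
  by (simp add: streett_def Fin_path_shift Infin_path_shift path_shift_in_space)

section \<open>Paths that leave a region\<close>

context markov_kernel
begin

text \<open>Split by the first exit time, which may be \<open>0\<close>. At that time the state lies
  outside \<open>I\<close>, so the future satisfies \<open>V\<close> with conditional probability at
  most \<open>d\<close>; the exit events \<open>D n\<close> are disjoint, so the bounds add up to at
  most \<open>d\<close>.\<close>

lemma emeasure_leaving_le:
  assumes \<mu>: "\<mu> \<in> space (prob_algebra M)"
    and V: "V \<in> sets (path_space M)" and I: "I \<in> sets M"
    and invariant: "\<And>\<omega> n. \<omega> \<in> V \<Longrightarrow> path_shift n \<omega> \<in> V"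
    and le: "\<And>s. s \<in> space M - I \<Longrightarrow> emeasure (markov_law M P (return M s)) V \<le> d"
  shows "emeasure (markov_law M P \<mu>) (V - stays M I) \<le> d"
proof -
  let ?L = "markov_law M P \<mu>"
  interpret L: prob_space ?L by (rule prob_space_markov_law[OF \<mu>])
  note sets_L = sets_markov_law[OF \<mu>]
  define D where "D n = {\<omega> \<in> space (path_space M). (\<forall>m<n. \<omega> m \<in> I) \<and> \<omega> n \<notin> I}" for n
  have D_prefix: "D n \<in> prefix_events M n" for n
    unfolding D_def using I by (intro prefix_eventsI) auto
  have D_sets [measurable]: "D n \<in> sets ?L" for n
    using prefix_events_sets[OF D_prefix] by (simp add: sets_L)
  have disjoint: "disjoint_family D"
    unfolding disjoint_family_on_def D_def by (auto elim: linorder_neqE_nat)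
  let ?S = "\<lambda>n. D n \<inter> {\<omega> \<in> space (path_space M). path_shift n \<omega> \<in> V}"
  have S: "?S n \<in> sets ?L" for n
  proof -
    have "{\<omega> \<in> space (path_space M). path_shift n \<omega> \<in> V} \<in> sets (path_space M)"
      using V by measurable
    then show ?thesis using D_sets[of n] by (simp add: sets_L sets.Int)
  qed
  have "V - stays M I \<subseteq> (\<Union>n. ?S n)"
  proof
    fix \<omega> assume \<omega>: "\<omega> \<in> V - stays M I"
    then have sp: "\<omega> \<in> space (path_space M)" using sets.sets_into_space[OF V] by auto
    with \<omega> have "\<exists>n. \<omega> n \<notin> I" by (auto simp: stays_def)
    then have "\<exists>n. \<omega> n \<notin> I \<and> (\<forall>m<n. \<omega> m \<in> I)" using exists_least_iff[of "\<lambda>n. \<omega> n \<notin> I"] by simp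
    then show "\<omega> \<in> (\<Union>n. ?S n)" using \<omega> sp invariant by (auto simp: D_def)
  qed
  then have "emeasure ?L (V - stays M I) \<le> emeasure ?L (\<Union>n. ?S n)"
    using S by (intro emeasure_mono) auto
  also have "\<dots> \<le> (\<Sum>n. emeasure ?L (?S n))"
    using S by (intro emeasure_subadditive_countably) auto
  also have "\<dots> \<le> (\<Sum>n. d * emeasure ?L (D n))"
    by (intro suminf_le emeasure_prefix_shift_le[OF \<mu> D_prefix V] le)
       (auto simp: D_def space_PiM)
  also have "\<dots> = d * emeasure ?L (\<Union>n. D n)"
    using disjoint by (simp add: ennreal_suminf_cmult suminf_emeasure image_subset_iff)
  also have "\<dots> \<le> d * 1"
    by (intro mult_left_mono L.measure_le_1) auto
  finally show ?thesis by simp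
qed

end

section \<open>Construction of the regions\<close>

theorem theorem3p12:
  fixes M \<mu> :: "'a measure" and P :: "'a \<Rightarrow> 'a measure"
    and k :: nat and A B :: "nat \<Rightarrow> 'a set"
  assumes "P \<in> M \<rightarrow>\<^sub>M prob_algebra M"
    and "prob_space \<mu>" and "sets \<mu> = sets M"
    and "\<And>i. i \<in> {1..k} \<Longrightarrow> A i \<in> sets M"
    and "\<And>i. i \<in> {1..k} \<Longrightarrow> B i \<in> sets M"
    and "measure (markov_law M P \<mu>) (streett M k A B) > 0"
  shows "\<forall>\<epsilon>::real. \<epsilon> > 0 \<longrightarrow>
    (\<exists>I J. I \<in> sets M \<and>
       (\<forall>i\<in>{1..k}. J i \<in> sets M \<and> J i \<subseteq> I - A i \<and>
          (SUP s\<in>J i. emeasure (markov_law M P (return M s)) (returns M (A i))) < 1 \<and>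
          (INF s\<in>I. emeasure (markov_law M P (return M s))
             (returns M (B i \<union> J i \<union> (space M - I)))) = 1) \<and>
       measure (markov_law M P \<mu>) (stays M I)
         \<ge> measure (markov_law M P \<mu>) (streett M k A B) - \<epsilon>)"
proof (intro allI impI)
  fix \<epsilon> :: real assume "\<epsilon> > 0"
  interpret markov_kernel M P by standard fact
  have \<mu>: "\<mu> \<in> space (prob_algebra M)"
    using assms(2,3) by (simp add: space_prob_algebra)
  let ?L = "markov_law M P \<mu>" and ?K = "\<lambda>s. markov_law M P (return M s)"
  interpret L: prob_space ?L by (rule prob_space_markov_law[OF \<mu>])
  define W where "W = streett M k A B"
  have W: "W \<in> sets (path_space M)"
    unfolding W_def using assms(4,5) by (rule sets_streett)
  have W_shift: "path_shift n \<omega> \<in> W \<longleftrightarrow> \<omega> \<in> W" if "\<omega> \<in> space (path_space M)" for n \<omega>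
    using that by (simp add: W_def streett_path_shift)
  note [measurable] = W borel_measurable_emeasure_markov_law
  \<comment> \<open>The minimum keeps \<open>I\<close> nonempty: an infimum over the empty set would be \<open>\<infinity>\<close>, not \<open>1\<close>.\<close>
  define d where "d = min \<epsilon> (measure ?L W / 2)"
  have d: "0 < d" "d \<le> \<epsilon>" "d < measure ?L W"
    using \<open>\<epsilon> > 0\<close> assms(6) by (auto simp: d_def W_def)
  define I where "I = {s \<in> space M. ennreal d \<le> emeasure (?K s) W}"
  \<comment> \<open>Any threshold strictly between 0 and 1 would serve: it bounds the supremum on
    \<open>J i\<close> away from 1 and the return probability on the rest of \<open>I - A i\<close>
    away from 0.\<close>
  define J where "J i = {s \<in> space M. s \<in> I \<and> s \<notin> A i \<and> emeasure (?K s) (returns M (A i)) \<le> ennreal (1/2)}" for i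
  have I [measurable]: "I \<in> sets M"
    unfolding I_def by measurable

  have "emeasure ?L (W - stays M I) \<le> ennreal d"
  proof (rule emeasure_leaving_le[OF \<mu> W I])
    show "path_shift n \<omega> \<in> W" if "\<omega> \<in> W" for \<omega> n
      using that W_shift sets.sets_into_space[OF W] by auto
  qed (auto simp: I_def)
  then have "measure ?L (W - stays M I) \<le> d"
    using d by (simp add: L.emeasure_eq_measure)
  moreover have "measure ?L W \<le> measure ?L (W - stays M I) + measure ?L (stays M I)"
  proof -
    have sets: "W - stays M I \<in> sets ?L" "stays M I \<in> sets ?L"
      using W sets_stays[OF I] by (auto simp: sets_markov_law[OF \<mu>])
    then have "measure ?L W \<le> measure ?L ((W - stays M I) \<union> stays M I)"
      by (intro L.finite_measure_mono sets.Un) auto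
    also have "\<dots> \<le> measure ?L (W - stays M I) + measure ?L (stays M I)"
      using sets by (rule measure_Un_le)
    finally show ?thesis .
  qed
  ultimately have stays: "measure ?L W - d \<le> measure ?L (stays M I)" by linarith
  have "I \<noteq> {}"
  proof
    assume "I = {}"
    \<comment> \<open>An empty \<open>I\<close> would force the Streett probability down to at most
      \<open>d\<close>, against the choice of \<open>d\<close>.\<close>
    then have "stays M I = {}" by (simp add: stays_def)
    with stays d show False by simp
  qed

  have "J i \<in> sets M \<and> J i \<subseteq> I - A i \<and>
      (SUP s\<in>J i. emeasure (?K s) (returns M (A i))) < 1 \<and>
      (INF s\<in>I. emeasure (?K s) (returns M (B i \<union> J i \<union> (space M - I)))) = 1"
    if i: "i \<in> {1..k}" for i
  proof (intro conjI)
    note [measurable] = assms(4,5)[OF i]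
    have R: "returns M (A i) \<in> sets (path_space M)" by measurable
    show Ji [measurable]: "J i \<in> sets M"
      unfolding J_def using R by measurable
    show "J i \<subseteq> I - A i" by (auto simp: J_def)
    \<comment> \<open>If \<open>J i\<close> is empty, the supremum in \<open>ennreal\<close> is
      0.\<close>
    have "(SUP s\<in>J i. emeasure (?K s) (returns M (A i))) \<le> ennreal (1/2)"
      by (rule SUP_least) (auto simp: J_def)
    also have "\<dots> < 1" by (subst ennreal_less_one_iff) auto
    finally show "(SUP s\<in>J i. emeasure (?K s) (returns M (A i))) < 1" .
    let ?T = "B i \<union> J i \<union> (space M - I)"
    have T: "returns M ?T \<in> sets (path_space M)" by measurable
    \<comment> \<open>The infimum is attained everywhere: from each state of \<open>I\<close> the
      return is almost sure. A path that never returns to \<open>?T\<close> stays in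
      \<open>I\<close> and avoids \<open>B i\<close> and \<open>J i\<close> at all positive times;
      such paths are covered by the null events \<open>E\<close> and \<open>F N\<close>.\<close>
    have "emeasure (?K s) (returns M ?T) = 1" if s: "s \<in> I" for s
    proof -
      have \<nu>: "return M s \<in> space (prob_algebra M)"
        using s by (intro return_in_prob_algebra) (auto simp: I_def)
      interpret K: prob_space "?K s" by (rule prob_space_markov_law[OF \<nu>])
      note sets_K = sets_markov_law[OF \<nu>] and space_K = space_markov_law[OF \<nu>]
      \<comment> \<open>Only times from 1 on are constrained, because return times ignore time
        0.\<close>
      define E where "E = {\<omega> \<in> space (path_space M). \<omega> \<notin> W \<and> (\<forall>n\<ge>1. \<omega> n \<in> I)}"
      define F where "F N = {\<omega> \<in> space (path_space M). \<forall>n\<ge>N. \<omega> n \<notin> A i \<and>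
        ennreal (1/2) \<le> emeasure (?K (\<omega> n)) (returns M (A i))}" for N
      have E: "E \<in> sets (path_space M)" unfolding E_def by measurable
      have F: "F N \<in> sets (path_space M)" for N unfolding F_def using R by measurable
      \<comment> \<open>The future event is \<open>W\<close> itself: its probability is at least
        \<open>d\<close> from every state of \<open>I\<close>, yet by shift invariance no shifted
        path of \<open>E\<close> lies in \<open>W\<close>.\<close>
      have "emeasure (?K s) E = 0"
        by (rule null_event[OF \<nu> W E d(1), of 1]) (auto simp: E_def I_def W_shift)
      then have E0: "E \<in> null_sets (?K s)" using E by (auto simp: sets_K)
      \<comment> \<open>The future event is now a return to \<open>A i\<close>, which keeps
        conditional probability at least \<open>1/2\<close> from time \<open>N\<close> on but never
        happens again.\<close>
      have "emeasure (?K s) (F N) = 0" for N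
        by (rule null_event[OF \<nu> R F, of "1/2" _ N])
           (auto simp: F_def returns_iff path_shift_apply)
      then have F0: "(\<Union>N. F N) \<in> null_sets (?K s)"
        using F by (intro null_sets_UN null_setsI) (auto simp: sets_K)
      have sub: "space (path_space M) - returns M ?T \<subseteq> E \<union> (\<Union>N. F N)"
      proof
        fix \<omega> assume \<omega>: "\<omega> \<in> space (path_space M) - returns M ?T"
        then have sp: "\<omega> \<in> space (path_space M)" "\<omega> n \<in> space M" for n
          by (auto simp: space_PiM)
        have stay: "\<omega> n \<in> I" "\<omega> n \<notin> B i" "\<omega> n \<notin> J i" if "1 \<le> n" for n
          using \<omega> that sp(2)[of n] by (auto simp: returns_iff)
        show "\<omega> \<in> E \<union> (\<Union>N. F N)"
        proof (cases "\<omega> \<in> W")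
          case False
          then show ?thesis using sp stay by (auto simp: E_def)
        next
          case True
          then have "\<omega> \<in> Fin M (A i) \<union> Infin M (B i)"
            using i by (auto simp: W_def streett_def)
          moreover have "\<omega> \<notin> Infin M (B i)"
            using stay(2) by (auto simp: Infin_iff intro!: exI[of _ 1])
          ultimately obtain N where N: "\<And>m. N \<le> m \<Longrightarrow> \<omega> m \<notin> A i"
            by (auto simp: Fin_iff)
          \<comment> \<open>From time \<open>N\<close> on the path avoids \<open>A i\<close>; from
            time 1 on it is in \<open>I\<close> but not in \<open>J i\<close>. Both together push
            the return probability above \<open>1/2\<close>.\<close>
          have "\<omega> \<in> F (max N 1)"
            using sp N stay by (fastforce simp: F_def J_def)
          then show ?thesis by blast
        qed
      qed
      have null: "E \<union> (\<Union>N. F N) \<in> null_sets (?K s)"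
        using E0 F0 by (rule null_sets.Un)
      have "space (path_space M) - returns M ?T \<in> sets (?K s)"
        unfolding sets_K using T by (rule sets.compl_sets)
      then have "space (path_space M) - returns M ?T \<in> null_sets (?K s)"
        by (rule null_sets_subset[OF null _ sub])
      then have "emeasure (?K s) (space (?K s) - (space (path_space M) - returns M ?T)) = emeasure (?K s) (space (?K s))"
        by (intro emeasure_Diff_null_set) auto
      moreover have "space (?K s) - (space (path_space M) - returns M ?T) = returns M ?T"
        using sets.sets_into_space[OF T] by (auto simp: space_K)
      ultimately show ?thesis by (simp add: K.emeasure_space_1)
    qed
    then show "(INF s\<in>I. emeasure (?K s) (returns M ?T)) = 1"
      using \<open>I \<noteq> {}\<close> by simp
  qed
  moreover have "measure ?L (stays M I) \<ge> measure ?L (streett M k A B) - \<epsilon>"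
    using stays d(2) by (simp add: W_def)
  ultimately show "\<exists>I J. I \<in> sets M \<and>
       (\<forall>i\<in>{1..k}. J i \<in> sets M \<and> J i \<subseteq> I - A i \<and>
          (SUP s\<in>J i. emeasure (?K s) (returns M (A i))) < 1 \<and>
          (INF s\<in>I. emeasure (?K s) (returns M (B i \<union> J i \<union> (space M - I)))) = 1) \<and>
       measure ?L (stays M I) \<ge> measure ?L (streett M k A B) - \<epsilon>"
    using I by (intro exI[of _ I] exI[of _ J]) blast
qed

end
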